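(* Let $n\ge p$ be positive integers, let $\bar X,\hat X\in\mathbb{R}^{n\times p}$, and define $X(t):=\bar X+t(\hat X-\bar X)$ for all $t\in[0,1]$. Then the following are equivalent: (i) $\|X(t)\|_*=\|\bar X\|_*$ for all $t\in[0,1]$. (ii) $\hat X$ and $\bar X$ are simultaneously polarizable and $\|\bar X\|_*=\|\hat X\|_*$.
   Context: $\|X\|_*=\operatorname{tr}(\sqrt{X^TX})$ is the nuclear norm (sum of the singular values). $\mathbb{S}^n_+$ is the cone of real symmetric positive semidefinite $n\times n$ matrices. The Stiefel manifold is $\mathcal{V}_{n,p}=\{U\in\mathbb{R}^{n\times p}: U^TU=I_p\}$. A matrix $U\in\mathcal{V}_{n,p}$ polarizes $X\in\mathbb{R}^{n\times p}$ if $XU^T\in\mathbb{S}^n_+$ (i.e. $XU^T$ is symmetric and positive semidefinite). Two matrices $X,\hat X\in\mathbb{R}^{n\times p}$ are simultaneously polarizable if there exists a single $U\in\mathcal{V}_{n,p}$ that polarizes both $X$ and $\hat X$. *)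

theory Defs
  imports "HOL-Analysis.Analysis"
begin

text \<open>
  A real matrix with rows indexed by \<open>'n\<close> and columns by \<open>'p\<close> has type
  \<open>real^'p^'n\<close>.
\<close>

definition sym_psd :: "real^'n^'n \<Rightarrow> bool" where
  "sym_psd A \<longleftrightarrow> transpose A = A \<and> (\<forall>x. 0 \<le> x \<bullet> (A *v x))"

text \<open>
  The principal square root; it is meaningful for symmetric positive semidefinite \<open>A\<close>,
  where exactly one symmetric positive semidefinite matrix squares to \<open>A\<close>.
\<close>
definition matrix_sqrt :: "real^'n^'n \<Rightarrow> real^'n^'n" where
  "matrix_sqrt A = (THE S. sym_psd S \<and> S ** S = A)"

definition nuclear_norm :: "real^'p^'n \<Rightarrow> real" where
  "nuclear_norm X = trace (matrix_sqrt (transpose X ** X))"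

definition stiefel :: "(real^'p^'n) set" where
  "stiefel = {U. transpose U ** U = mat 1}"

definition polarizes :: "real^'p^'n \<Rightarrow> real^'p^'n \<Rightarrow> bool" where
  "polarizes U X \<longleftrightarrow> U \<in> stiefel \<and> sym_psd (X ** transpose U)"

definition simultaneously_polarizable :: "real^'p^'n \<Rightarrow> real^'p^'n \<Rightarrow> bool" where
  "simultaneously_polarizable X Y \<longleftrightarrow> (\<exists>U\<in>stiefel. polarizes U X \<and> polarizes U Y)"

end

theory Submission
  imports Defs
begin

text \<open>
  The nuclear norm of \<open>X\<close> is the maximum of the linear functional \<open>V \<mapsto> X \<bullet> V\<close> over the compact Stiefel
  manifold, and the maximizers are exactly the polarizers of \<open>X\<close>. Comparing a maximizer \<open>U\<close> with
  \<open>R ** U\<close> for orthogonal \<open>R\<close> shows that \<open>X U\<^sup>T\<close> is positive semidefinite, and then \<open>X\<^sup>T U\<close> is the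
  square root of \<open>X\<^sup>T X\<close>; no spectral theorem is needed.

  If the norm is constant on the segment, a maximizer for the midpoint must be a maximizer for both
  endpoints. Conversely, a common polarizer polarizes the whole segment, along which the norm is then
  the affine function \<open>t \<mapsto> X(t) \<bullet> U\<close>.
\<close>

section \<open>Matrix algebra and a first-order criterion for quadratics\<close>

lemma matrix_diff_ldistrib:
  fixes A :: "real^'m^'n" and B C :: "real^'k^'m"
  shows "A ** (B - C) = A ** B - A ** C"
  by (simp add: matrix_matrix_mult_def vec_eq_iff right_diff_distrib sum_subtractf)

lemma matrix_diff_rdistrib:
  fixes A B :: "real^'m^'n" and C :: "real^'k^'m"
  shows "(A - B) ** C = A ** C - B ** C"
  by (simp add: matrix_matrix_mult_def vec_eq_iff left_diff_distrib sum_subtractf)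

lemma inner_matrix_eq_trace:
  fixes X Y :: "real^'p^'n"
  shows "X \<bullet> Y = trace (X ** transpose Y)"
  by (simp add: inner_vec_def trace_def matrix_matrix_mult_def transpose_def)

lemma inner_transpose_mult:
  fixes A :: "real^'m^'n"
  shows "x \<bullet> (transpose A *v y) = (A *v x) \<bullet> y"
  by (metis dot_lmul_matrix inner_commute transpose_matrix_vector)

lemma inner_quadratic_form_commute:
  fixes A :: "real^'n^'n"
  assumes "transpose A = A"
  shows "x \<bullet> (A *v y) = y \<bullet> (A *v x)"
  using inner_transpose_mult[of x A y] assms by (simp add: inner_commute)

lemma quadratic_nonneg_imp_linear_coeff_zero:
  fixes b c :: real
  assumes "\<And>s. 0 \<le> s * b + s\<^sup>2 * c"
  shows "b = 0"
proof (rule ccontr)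
  assume b: "b \<noteq> 0"
  \<comment> \<open>Since \<open>k\<close> is positive and exceeds \<open>c\<close>, at
    \<open>s = - b / k\<close> the quadratic term cannot compensate the negative linear
    term.\<close>
  define k where "k = \<bar>c\<bar> + 1"
  have k: "k > 0" "c < k" by (auto simp: k_def)
  have "0 \<le> (- b / k) * b + (- b / k)\<^sup>2 * c" by (rule assms)
  also have "\<dots> = (b\<^sup>2 / k\<^sup>2) * (c - k)"
    using k by (simp add: field_simps power2_eq_square)
  also have "\<dots> < 0"
    using b k by (intro mult_pos_neg) auto
  finally show False by simp
qed

section \<open>Positive semidefinite matrices and their square roots\<close>

lemma sym_psd_add:
  assumes "sym_psd A" "sym_psd B"
  shows "sym_psd (A + B)"
  using assms
  by (auto simp: sym_psd_def transpose_def vec_eq_iff matrix_vector_mult_add_rdistrib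
      inner_add_right)

lemma sym_psd_scaleR:
  assumes "sym_psd A" "0 \<le> c"
  shows "sym_psd (c *\<^sub>R A)"
  using assms by (auto simp: sym_psd_def transpose_scalar scaleR_matrix_vector_assoc[symmetric])

lemma sym_psd_congruence:
  fixes A :: "real^'n^'n" and D :: "real^'p^'n"
  assumes "sym_psd A"
  shows "sym_psd (transpose D ** A ** D)"
  unfolding sym_psd_def
proof (intro conjI allI)
  show "transpose (transpose D ** A ** D) = transpose D ** A ** D"
    using assms by (simp add: sym_psd_def matrix_transpose_mul matrix_mul_assoc)
  fix x
  have "x \<bullet> (transpose D ** A ** D *v x) = (D *v x) \<bullet> (A *v (D *v x))"
    by (metis inner_transpose_mult matrix_vector_mul_assoc)
  then show "0 \<le> x \<bullet> (transpose D ** A ** D *v x)"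
    using assms by (simp add: sym_psd_def)
qed

text \<open>Such an \<open>x\<close> minimizes the quadratic form, so its first variation vanishes;
  in the direction \<open>A *v x\<close> that variation is twice the squared norm of
  \<open>A *v x\<close>.\<close>

lemma sym_psd_mult_eq_0:
  assumes "sym_psd A" "x \<bullet> (A *v x) = 0"
  shows "A *v x = 0"
proof -
  let ?y = "A *v x"
  have "0 \<le> s * (2 * (?y \<bullet> ?y)) + s\<^sup>2 * (?y \<bullet> (A *v ?y))" for s
  proof -
    have "0 \<le> (x + s *\<^sub>R ?y) \<bullet> (A *v (x + s *\<^sub>R ?y))"
      using assms(1) by (simp add: sym_psd_def)
    moreover have "x \<bullet> (A *v ?y) = ?y \<bullet> ?y"
      using assms(1) inner_quadratic_form_commute[of A x ?y] by (simp add: sym_psd_def)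
    ultimately show ?thesis
      using assms(2)
      by (simp add: matrix_vector_right_distrib matrix_vector_mult_scaleR inner_add_left
          inner_add_right algebra_simps power2_eq_square)
  qed
  from quadratic_nonneg_imp_linear_coeff_zero[OF this] show ?thesis by simp
qed

lemma congruence_diag:
  fixes A :: "real^'n^'n" and D :: "real^'p^'n"
  shows "(transpose D ** A ** D) $ i $ i = column i D \<bullet> (A *v column i D)"
proof -
  have "(transpose D ** A ** D) $ i $ i = axis i 1 \<bullet> ((transpose D ** A ** D) *v axis i 1)"
    by (simp add: inner_axis' matrix_vector_mult_basis column_def)
  also have "\<dots> = (D *v axis i 1) \<bullet> (A *v (D *v axis i 1))"
    by (metis inner_transpose_mult matrix_vector_mul_assoc)
  finally show ?thesis by (simp add: matrix_vector_mult_basis)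
qed

text \<open>With \<open>D = P - Q\<close>, the mixed products in \<open>P ** D + D ** Q\<close>
  cancel, leaving 0. Multiplying by \<open>D\<close> and taking traces gives a vanishing sum of
  nonnegative forms at the columns of \<open>D\<close>, so \<open>P\<close> and \<open>Q\<close>
  both annihilate these columns.\<close>

lemma sym_psd_sqrt_unique:
  fixes P Q :: "real^'n^'n"
  assumes P: "sym_psd P" and Q: "sym_psd Q" and eq: "P ** P = Q ** Q"
  shows "P = Q"
proof -
  define D where "D = P - Q"
  have symD: "transpose D = D"
    using P Q by (simp add: D_def sym_psd_def transpose_def vec_eq_iff)
  have "P ** D + D ** Q = 0"
    by (simp add: D_def matrix_diff_ldistrib matrix_diff_rdistrib eq)
  then have "P ** D = 0 - D ** Q" by (simp add: eq_neg_iff_add_eq_0)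
  then have "trace (D ** P ** D) = - trace (D ** D ** Q)"
    by (metis matrix_mul_assoc matrix_diff_ldistrib times0_right trace_sub trace_0 mat_0 diff_0)
  also have "trace (D ** D ** Q) = trace (D ** Q ** D)"
    by (metis matrix_mul_assoc trace_mul_sym)
  finally have "trace (D ** P ** D) + trace (D ** Q ** D) = 0" by simp
  then have "(\<Sum>i\<in>UNIV. column i D \<bullet> (P *v column i D) + column i D \<bullet> (Q *v column i D)) = 0"
    using congruence_diag[of D P] congruence_diag[of D Q]
    by (simp add: trace_def symD sum.distrib)
  then have sum0: "column i D \<bullet> (P *v column i D) + column i D \<bullet> (Q *v column i D) = 0" for i
    using P Q by (subst (asm) sum_nonneg_eq_0_iff) (auto simp: sym_psd_def)
  have "column i D = 0" for i
  proof -
    let ?d = "column i D"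
    have "0 \<le> ?d \<bullet> (P *v ?d)" "0 \<le> ?d \<bullet> (Q *v ?d)"
      using P Q by (auto simp: sym_psd_def)
    with sum0[of i] have "P *v ?d = 0" "Q *v ?d = 0"
      by (auto intro!: sym_psd_mult_eq_0 P Q)
    then have "D *v ?d = 0" by (simp add: D_def matrix_vector_mult_diff_rdistrib)
    \<comment> \<open>Since \<open>?d\<close> is \<open>D\<close> applied to a basis vector,
      symmetry moves one factor \<open>D\<close> across, and \<open>D *v ?d = 0\<close>
      applies.\<close>
    moreover have "?d \<bullet> ?d = axis i 1 \<bullet> (D *v ?d)"
      using inner_transpose_mult[of "axis i 1" D ?d] symD
      by (simp add: matrix_vector_mult_basis)
    ultimately show ?thesis by simp
  qed
  then have "D = 0" by (simp add: vec_eq_iff column_def)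
  then show ?thesis by (simp add: D_def)
qed

lemma matrix_sqrt_eq:
  assumes "sym_psd S" "S ** S = A"
  shows "matrix_sqrt A = S"
  unfolding matrix_sqrt_def
  by (rule the_equality) (use assms in \<open>auto intro: sym_psd_sqrt_unique\<close>)

section \<open>A trace criterion for positive semidefiniteness\<close>

definition outer_product :: "real^'n \<Rightarrow> real^'m \<Rightarrow> real^'m^'n" where
  "outer_product a b = (\<chi> i j. a $ i * b $ j)"

lemma trace_outer_product: "trace (outer_product a b) = a \<bullet> b"
  by (simp add: trace_def outer_product_def inner_vec_def)

lemma mult_outer_product: "A ** outer_product a b = outer_product (A *v a) b"
  by (simp add: outer_product_def matrix_matrix_mult_def matrix_vector_mult_def vec_eq_iff
      sum_distrib_right mult.assoc)

lemma outer_product_mult_vector: "outer_product a b *v x = (b \<bullet> x) *\<^sub>R a"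
  by (simp add: outer_product_def matrix_vector_mult_def vec_eq_iff inner_vec_def
      sum_distrib_right sum_distrib_left mult_ac)

lemma outer_product_scaleR_left: "outer_product (c *\<^sub>R a) b = c *\<^sub>R outer_product a b"
  by (simp add: outer_product_def vec_eq_iff)

text \<open>The reflection in the hyperplane orthogonal to \<open>w\<close>. Dividing by
  \<open>w \<bullet> w\<close> allows vectors such as \<open>w + s u\<close> to be used without
  normalization.\<close>

definition householder :: "real^'n \<Rightarrow> real^'n^'n" where
  "householder w = mat 1 - (2 / (w \<bullet> w)) *\<^sub>R outer_product w w"

lemma mult_householder:
  "M ** householder w = M - (2 / (w \<bullet> w)) *\<^sub>R outer_product (M *v w) w"
  by (simp add: householder_def matrix_diff_ldistrib mult_outer_product
      matrix_vector_mult_scaleR flip: outer_product_scaleR_left)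

lemma householder_mult_self:
  assumes "w \<noteq> 0"
  shows "householder w *v w = - w"
  using assms
  by (simp add: householder_def matrix_vector_mult_diff_rdistrib outer_product_mult_vector
      vec_eq_iff flip: scaleR_matrix_vector_assoc)

lemma orthogonal_matrix_householder:
  assumes "w \<noteq> 0"
  shows "orthogonal_matrix (householder w)"
proof -
  have "transpose (householder w) = householder w"
    by (simp add: householder_def transpose_def outer_product_def vec_eq_iff mat_def mult.commute)
  moreover have "householder w ** householder w = mat 1"
    by (subst mult_householder)
      (simp add: householder_mult_self[OF assms],
       simp add: householder_def outer_product_def vec_eq_iff)
  ultimately show ?thesis by (simp add: orthogonal_matrix)
qed

text \<open>
  One reflection gives nonnegativity of the quadratic form. Symmetry comes from the product of the
  reflections along \<open>w\<close> and \<open>w + s u\<close>, a rotation whose first-order term in \<open>s\<close> is the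
  antisymmetric part of \<open>M\<close>.
\<close>
lemma sym_psd_if_trace_maximal:
  fixes M :: "real^'n^'n"
  assumes max: "\<And>R. orthogonal_matrix R \<Longrightarrow> trace (M ** R) \<le> trace M"
  shows "sym_psd M"
proof -
  have nonneg: "0 \<le> x \<bullet> (M *v x)" for x
  proof (cases "x = 0")
    case False
    then have "trace (M ** householder x) \<le> trace M"
      by (intro max orthogonal_matrix_householder)
    then have "0 \<le> (2 / (x \<bullet> x)) * (x \<bullet> (M *v x))"
      by (simp add: mult_householder trace_sub trace_outer_product inner_commute
          flip: outer_product_scaleR_left)
    moreover have "0 < x \<bullet> x" using False by simp
    ultimately show ?thesis by (simp add: zero_le_mult_iff zero_le_divide_iff)
  qed simp
  have "M $ j $ i = M $ i $ j" if "i \<noteq> j" for i j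
  proof -
    define w u :: "real^'n" where "w = axis i 1" and "u = axis j 1"
    let ?Q = "\<lambda>x y. x \<bullet> (M *v y)"
    have ip: "w \<bullet> w = 1" "u \<bullet> u = 1" "w \<bullet> u = 0" "u \<bullet> w = 0"
      using that by (auto simp: w_def u_def inner_axis_axis)
    have "0 \<le> s * (?Q w u - ?Q u w) + s\<^sup>2 * (?Q u u + ?Q w w)" for s
    proof -
      define v where "v = w + s *\<^sub>R u"
      have vv: "v \<bullet> v = 1 + s\<^sup>2" and wv: "w \<bullet> v = 1" "v \<bullet> w = 1"
        by (simp_all add: v_def inner_add_left inner_add_right ip power2_eq_square)
      have pos: "0 < 1 + s\<^sup>2" by (simp add: add_pos_nonneg)
      have "w \<noteq> 0" "v \<noteq> 0" using ip vv pos by auto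
      then have le: "trace (M ** (householder w ** householder v)) \<le> trace M"
        by (intro max orthogonal_matrix_mul orthogonal_matrix_householder)
      \<comment> \<open>\<open>Z\<close> is half the loss of trace. Multiplying it by
        \<open>1 + v\<close> with \<open>v = s * s\<close> clears the denominator; the constant
        terms cancel and the coefficient of \<open>s\<close> is the difference of two opposite
        entries of \<open>M\<close>.\<close>
      define Z where "Z = ?Q w w + (1 / (1 + s\<^sup>2)) * (?Q v v - 2 * ?Q v w)"
      have "trace (M ** (householder w ** householder v)) = trace M - 2 * Z"
        unfolding matrix_mul_assoc Z_def
        by (simp add: mult_householder trace_sub trace_outer_product ip vv wv
            matrix_vector_mult_diff_rdistrib outer_product_mult_vector inner_diff_right
            inner_commute right_diff_distrib diff_divide_distrib
            flip: outer_product_scaleR_left scaleR_matrix_vector_assoc)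
      with le have "0 \<le> (1 + s\<^sup>2) * Z" using pos by simp
      also have "\<dots> = (1 + s\<^sup>2) * ?Q w w + ?Q v v - 2 * ?Q v w"
        using pos by (simp add: Z_def distrib_left)
      also have "\<dots> = s * (?Q w u - ?Q u w) + s\<^sup>2 * (?Q u u + ?Q w w)"
        by (simp add: v_def matrix_vector_right_distrib matrix_vector_mult_scaleR inner_add_left
            inner_add_right algebra_simps power2_eq_square)
      finally show ?thesis .
    qed
    from quadratic_nonneg_imp_linear_coeff_zero[OF this] have "?Q u w = ?Q w u" by simp
    then show ?thesis
      by (simp add: u_def w_def inner_axis' matrix_vector_mult_basis column_def)
  qed
  then have "transpose M = M"
    by (metis (mono_tags, lifting) transpose_def vec_eq_iff vec_lambda_beta)
  with nonneg show ?thesis by (simp add: sym_psd_def)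
qed

section \<open>The nuclear norm as a maximum over the Stiefel manifold\<close>

lemma nuclear_norm_eq_inner_if_polarizes:
  fixes U X :: "real^'p^'n"
  assumes "polarizes U X"
  shows "nuclear_norm X = X \<bullet> U"
proof -
  let ?A = "X ** transpose U"
  \<comment> \<open>As a congruence of \<open>?A\<close>, \<open>P\<close> is visibly positive
    semidefinite; it also equals both \<open>transpose U ** X\<close> and
    \<open>transpose X ** U\<close>.\<close>
  define P where "P = transpose U ** ?A ** U"
  have U: "transpose U ** U = mat 1" and A: "sym_psd ?A"
    using assms by (auto simp: polarizes_def stiefel_def)
  have symA: "U ** transpose X = ?A"
    using A by (simp add: sym_psd_def matrix_transpose_mul)
  have P1: "P = transpose U ** X"
    by (metis P_def U matrix_mul_assoc matrix_mul_rid)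
  have P2: "P = transpose X ** U"
    by (metis P_def U symA matrix_mul_assoc matrix_mul_lid)
  \<comment> \<open>The projection \<open>U ** transpose U\<close> fixes \<open>X\<close>, because
    \<open>X = ?A ** U = U ** transpose X ** U\<close> has its columns in the range of
    \<open>U\<close>. Hence it drops out of \<open>P ** P\<close>.\<close>
  have "U ** transpose U ** X = U ** transpose U ** (?A ** U)"
    by (metis U matrix_mul_assoc matrix_mul_rid)
  also have "\<dots> = U ** (transpose U ** U) ** transpose X ** U"
    by (simp add: symA[symmetric] matrix_mul_assoc)
  also have "\<dots> = X"
    by (metis U symA matrix_mul_assoc matrix_mul_rid)
  finally have "P ** P = transpose X ** X"
    by (metis P1 P2 matrix_mul_assoc)
  moreover have "sym_psd P"
    unfolding P_def by (rule sym_psd_congruence) (rule A)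
  ultimately have "nuclear_norm X = trace P"
    by (simp add: nuclear_norm_def matrix_sqrt_eq)
  also have "\<dots> = X \<bullet> U"
    by (metis P1 inner_matrix_eq_trace trace_mul_sym)
  finally show ?thesis .
qed

lemma stiefel_orthogonal_mult:
  assumes "U \<in> stiefel" "orthogonal_matrix R"
  shows "R ** U \<in> stiefel"
proof -
  have "transpose (R ** U) ** (R ** U) = transpose U ** (transpose R ** R) ** U"
    by (simp add: matrix_transpose_mul matrix_mul_assoc)
  then show ?thesis
    using assms by (simp add: stiefel_def orthogonal_matrix)
qed

text \<open>The competitors \<open>transpose R ** U\<close> suffice: their values are the traces of
  \<open>X ** transpose U ** R\<close>, so the trace criterion applies to
  \<open>X ** transpose U\<close>.\<close>

lemma polarizes_if_maximal:
  fixes U X :: "real^'p^'n"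
  assumes U: "U \<in> stiefel" and max: "\<And>V. V \<in> stiefel \<Longrightarrow> X \<bullet> V \<le> X \<bullet> U"
  shows "polarizes U X"
proof -
  have "sym_psd (X ** transpose U)"
  proof (rule sym_psd_if_trace_maximal)
    fix R :: "real^'n^'n"
    assume "orthogonal_matrix R"
    then have "X \<bullet> (transpose R ** U) \<le> X \<bullet> U"
      by (intro max stiefel_orthogonal_mult U) simp
    then show "trace (X ** transpose U ** R) \<le> trace (X ** transpose U)"
      by (simp add: inner_matrix_eq_trace matrix_transpose_mul matrix_mul_assoc)
  qed
  with U show ?thesis by (simp add: polarizes_def)
qed

text \<open>An injection of the column indices into the row indices selects distinct standard basis
  vectors as orthonormal columns.\<close>

lemma stiefel_nonempty:
  assumes "CARD('p::finite) \<le> CARD('n::finite)"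
  shows "(stiefel :: (real^'p^'n) set) \<noteq> {}"
proof -
  obtain f :: "'p \<Rightarrow> 'n" where f: "inj f"
    using card_le_inj[of "UNIV :: 'p set" "UNIV :: 'n set"] assms by auto
  let ?U = "(\<chi> i j. if i = f j then 1 else 0) :: real^'p^'n"
  have "transpose ?U ** ?U = mat 1"
    using f by (auto simp: vec_eq_iff matrix_matrix_mult_def transpose_def mat_def inj_eq
        if_distrib[where f = "\<lambda>x. x * _"] cong: if_cong)
  then show ?thesis by (auto simp: stiefel_def)
qed

lemma compact_stiefel: "compact (stiefel :: (real^'p^'n) set)"
proof -
  have "norm U \<le> sqrt (real CARD('p))" if "U \<in> stiefel" for U :: "real^'p^'n"
  proof -
    have "U \<bullet> U = trace (transpose U ** U)"
      by (metis inner_matrix_eq_trace trace_mul_sym)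
    also have "\<dots> = real CARD('p)"
      using that by (simp add: stiefel_def trace_I)
    finally show ?thesis by (simp add: norm_eq_sqrt_inner)
  qed
  then have "bounded (stiefel :: (real^'p^'n) set)"
    by (auto simp: bounded_iff)
  moreover have "closed (stiefel :: (real^'p^'n) set)"
    unfolding stiefel_def matrix_matrix_mult_def transpose_def
    by (intro closed_Collect_eq continuous_intros)
  ultimately show ?thesis by (simp add: compact_eq_bounded_closed)
qed

lemma exists_polarizing:
  fixes X :: "real^'p^'n"
  assumes "CARD('p) \<le> CARD('n)"
  obtains U where "polarizes U X" "\<And>V. V \<in> stiefel \<Longrightarrow> X \<bullet> V \<le> X \<bullet> U"
proof -
  have "continuous_on stiefel (\<lambda>V. X \<bullet> V)" by (intro continuous_intros)
  from continuous_attains_sup[OF compact_stiefel stiefel_nonempty[OF assms] this]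
  show thesis using that polarizes_if_maximal by metis
qed

text \<open>A maximizer of \<open>X \<bullet> V\<close> polarizes \<open>X\<close>, so the maximal
  value is the nuclear norm.\<close>

lemma inner_le_nuclear_norm:
  fixes X V :: "real^'p^'n"
  assumes "CARD('p) \<le> CARD('n)" "V \<in> stiefel"
  shows "X \<bullet> V \<le> nuclear_norm X"
  using exists_polarizing[OF assms(1), of X] nuclear_norm_eq_inner_if_polarizes assms(2) by metis

lemma polarizes_iff_inner_eq_nuclear_norm:
  fixes U X :: "real^'p^'n"
  assumes "CARD('p) \<le> CARD('n)" "U \<in> stiefel"
  shows "polarizes U X \<longleftrightarrow> X \<bullet> U = nuclear_norm X"
  using inner_le_nuclear_norm[OF assms(1)] nuclear_norm_eq_inner_if_polarizes
    polarizes_if_maximal[OF assms(2)] by metis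

section \<open>Polarizers and the nuclear norm along a segment\<close>

lemma polarizes_convex_combination:
  assumes "polarizes U X" "polarizes U Y" "0 \<le> a" "0 \<le> b"
  shows "polarizes U (a *\<^sub>R X + b *\<^sub>R Y)"
proof -
  have "(a *\<^sub>R X + b *\<^sub>R Y) ** transpose U
      = a *\<^sub>R (X ** transpose U) + b *\<^sub>R (Y ** transpose U)"
    by (simp add: matrix_matrix_mult_def vec_eq_iff distrib_right sum.distrib sum_distrib_left
        mult.assoc)
  with assms show ?thesis
    by (simp add: polarizes_def sym_psd_add sym_psd_scaleR)
qed

theorem theorem3p4:
  fixes Xbar Xhat :: "real^'p^'n" and X :: "real \<Rightarrow> real^'p^'n"
  assumes "CARD('p) \<le> CARD('n)"
    and "\<And>t. t \<in> {0..1} \<Longrightarrow> X t = Xbar + t *\<^sub>R (Xhat - Xbar)"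
  shows "(\<forall>t\<in>{0..1}. nuclear_norm (X t) = nuclear_norm Xbar) \<longleftrightarrow>
    (simultaneously_polarizable Xhat Xbar \<and> nuclear_norm Xbar = nuclear_norm Xhat)"
proof
  assume const: "\<forall>t\<in>{0..1}. nuclear_norm (X t) = nuclear_norm Xbar"
  have eq: "nuclear_norm Xbar = nuclear_norm Xhat"
    using const[rule_format, of 1] assms(2)[of 1] by simp
  obtain U where U: "polarizes U (X (1/2))"
    using exists_polarizing[OF assms(1)] by metis
  then have St: "U \<in> stiefel" by (simp add: polarizes_def)
  have "X (1/2) \<bullet> U = nuclear_norm Xbar"
    using const[rule_format, of "1/2"] nuclear_norm_eq_inner_if_polarizes[OF U] by simp
  moreover have "X (1/2) \<bullet> U = (Xbar \<bullet> U + Xhat \<bullet> U) / 2"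
    by (simp add: assms(2) inner_add_left inner_diff_left field_simps)
  \<comment> \<open>The two inner products are bounded by the same number and their mean equals it,
    so neither can fall short.\<close>
  ultimately have "Xbar \<bullet> U = nuclear_norm Xbar" "Xhat \<bullet> U = nuclear_norm Xhat"
    using inner_le_nuclear_norm[OF assms(1) St, of Xbar]
      inner_le_nuclear_norm[OF assms(1) St, of Xhat] eq
    by auto
  then show "simultaneously_polarizable Xhat Xbar \<and> nuclear_norm Xbar = nuclear_norm Xhat"
    unfolding simultaneously_polarizable_def
    using polarizes_iff_inner_eq_nuclear_norm[OF assms(1) St] St eq by blast
next
  assume R: "simultaneously_polarizable Xhat Xbar \<and> nuclear_norm Xbar = nuclear_norm Xhat"
  then obtain U where U: "polarizes U Xhat" "polarizes U Xbar"
    by (auto simp: simultaneously_polarizable_def)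
  show "\<forall>t\<in>{0..1}. nuclear_norm (X t) = nuclear_norm Xbar"
  proof
    fix t :: real
    assume t: "t \<in> {0..1}"
    have Xt: "X t = (1 - t) *\<^sub>R Xbar + t *\<^sub>R Xhat"
      using assms(2)[OF t] by (simp add: algebra_simps)
    have "polarizes U (X t)"
      unfolding Xt using U t by (intro polarizes_convex_combination) auto
    from nuclear_norm_eq_inner_if_polarizes[OF this]
    have "nuclear_norm (X t) = (1 - t) * nuclear_norm Xbar + t * nuclear_norm Xhat"
      using U by (simp add: Xt inner_add_left nuclear_norm_eq_inner_if_polarizes)
    then show "nuclear_norm (X t) = nuclear_norm Xbar"
      using R by (simp add: algebra_simps)
  qed
qed

end
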